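(* Let $\lambda$ be a real number with $\lambda>-1$, $\lambda\neq 0$, and let $x$ be a real number (or an indeterminate). For every integer $n\ge0$, \[ \mathrm{Bel}_{n,\lambda}(x)=\sum_{k=0}^{n}\sum_{m=0}^{k}\left(\frac{\log(1+\lambda)}{\lambda}\right)^{m}S_{1}(n,k)\,S_{2}(k,m)\,\lambda^{n-k}x^{m}. \]
   Context: The degenerate Bell polynomials $\mathrm{Bel}_{n,\lambda}(x)$ are defined by the generating function (as a power series in $t$) \[ (1+\lambda)^{\frac{x}{\lambda}\left((1+\lambda t)^{1/\lambda}-1\right)}=\exp\!\Big(\tfrac{x}{\lambda}\log(1+\lambda)\big((1+\lambda t)^{1/\lambda}-1\big)\Big)=\sum_{n=0}^{\infty}\mathrm{Bel}_{n,\lambda}(x)\frac{t^{n}}{n!}, \] where $(1+\lambda t)^{1/\lambda}=\exp\big(\tfrac1\lambda\log(1+\lambda t)\big)$. $S_1(n,l)$ are the (signed) Stirling numbers of the first kind, defined by $x(x-1)\cdots(x-n+1)=\sum_{l=0}^{n}S_1(n,l)x^l$, and $S_2(n,l)$ are the Stirling numbers of the second kind, defined by $x^n=\sum_{l=0}^{n}S_2(n,l)\,x(x-1)\cdots(x-l+1)$. *)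

theory Defs
  imports
    "HOL-Computational_Algebra.Computational_Algebra"
    "HOL-Combinatorics.Stirling"
begin

text \<open>
  Signed Stirling numbers of the first kind, as the coefficients of the falling factorial
  polynomial. The constant \<open>stirling\<close> of the library is the unsigned version.
\<close>

definition signed_stirling :: "nat \<Rightarrow> nat \<Rightarrow> int" where
  "signed_stirling n l = coeff (\<Prod>i<n. [:- int i, 1:]) l"

lemma falling_factorial_eq_sum_signed_stirling:
  "(\<Prod>i<n. x - int i) = (\<Sum>l\<le>n. signed_stirling n l * x ^ l)"
proof -
  let ?p = "\<Prod>i<n. [:- int i, 1:]"
  have "degree ?p = n"
    by (subst degree_prod_eq_sum_degree) auto
  moreover have "poly ?p x = (\<Prod>i<n. x - int i)"
    by (simp add: poly_prod)
  ultimately show ?thesis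
    using poly_altdef[of ?p x] by (simp add: signed_stirling_def)
qed

text \<open>
  The library introduces the Stirling numbers of the second kind by their recurrence; they are
  the coefficients expressing powers in terms of falling factorials.
\<close>

lemma power_eq_sum_Stirling:
  fixes x :: "'a::comm_ring_1"
  shows "x ^ n = (\<Sum>l\<le>n. of_nat (Stirling n l) * (\<Prod>i<l. x - of_nat i))"
proof (induction n)
  case 0
  show ?case by simp
next
  case (Suc n)
  define F where "F = (\<lambda>l. \<Prod>i<l. x - of_nat i)"
  have F_Suc: "x * F l = F (Suc l) + of_nat l * F l" for l
    by (simp add: F_def algebra_simps)
  have "x ^ Suc n = (\<Sum>l\<le>n. of_nat (Stirling n l) * (x * F l))"
    using Suc by (simp add: F_def sum_distrib_left mult_ac)
  also have "\<dots> = (\<Sum>l\<le>n. of_nat (Stirling n l) * F (Suc l))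
                + (\<Sum>l\<le>n. of_nat (l * Stirling n l) * F l)"
    by (simp add: F_Suc algebra_simps sum.distrib)
  also have "(\<Sum>l\<le>n. of_nat (l * Stirling n l) * F l)
                = (\<Sum>l\<le>Suc n. of_nat (l * Stirling n l) * F l)"
    by simp
  also have "\<dots> = (\<Sum>l\<le>n. of_nat (Suc l * Stirling n (Suc l)) * F (Suc l))"
    by (subst sum.atMost_Suc_shift) simp
  also have "(\<Sum>l\<le>n. of_nat (Stirling n l) * F (Suc l)) + \<dots>
                = (\<Sum>l\<le>n. of_nat (Stirling (Suc n) (Suc l)) * F (Suc l))"
    by (simp add: sum.distrib[symmetric] algebra_simps)
  also have "\<dots> = (\<Sum>l\<le>Suc n. of_nat (Stirling (Suc n) l) * F l)"
    by (subst sum.atMost_Suc_shift) simp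
  finally show ?case by (simp add: F_def)
qed

text \<open>
  The formal power series of $(1 + \lambda t)^{1/\lambda} = \exp(\frac{1}{\lambda}\log(1+\lambda t))$
  in $t$. The series \<open>fps_exp c\<close> is $e^{ct}$ and \<open>fps_ln 1\<close> is $\log(1+t)$.
\<close>

definition degenerate_exp :: "real \<Rightarrow> real fps" where
  "degenerate_exp lam = fps_exp (1 / lam) oo (fps_ln 1 oo (fps_const lam * fps_X))"

definition degenerate_bell :: "nat \<Rightarrow> real \<Rightarrow> real \<Rightarrow> real" where
  "degenerate_bell n lam x =
     fact n * fps_nth (fps_exp (x / lam * ln (1 + lam)) oo (degenerate_exp lam - 1)) n"

text \<open>
  The same for an indeterminate $x$: the generating function is now a power series in $t$ over
  the ring of real polynomials in $x$. As \<open>fps_exp\<close> is only available over fields, the series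
  $e^{pt}$ for a polynomial $p$ is spelled out.
\<close>

definition fps_exp_poly :: "real poly \<Rightarrow> real poly fps" where
  "fps_exp_poly p = Abs_fps (\<lambda>n. smult (1 / fact n) (p ^ n))"

definition degenerate_bell_poly :: "nat \<Rightarrow> real \<Rightarrow> real poly" where
  "degenerate_bell_poly n lam =
     fact n * fps_nth (fps_exp_poly (smult (1 / lam * ln (1 + lam)) [:0, 1:])
       oo (Abs_fps (\<lambda>k. [:fps_nth (degenerate_exp lam) k:]) - 1)) n"

end

theory Submission
  imports Defs
begin

text \<open>
  Write $D$ for the series of $(1+\lambda t)^{1/\lambda}$ and $E = D - 1$. The powers of $D$ are
  binomial series, $D^j = (1+\lambda t)^{j/\lambda}$, so $n!\,[t^n]\,D^j = \prod_{i<n}(j - i\lambda)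
  = \sum_k S_1(n,k)\lambda^{n-k}j^k$; expanding $j^k$ in falling factorials turns this into
  $\sum_m \binom{j}{m}\, m! \sum_k S_1(n,k)S_2(k,m)\lambda^{n-k}$. On the other hand
  $D^j = \sum_m \binom{j}{m}E^m$. Both being valid for all natural $j$, binomial inversion yields
  $n!\,[t^n]\,E^m = m! \sum_k S_1(n,k)S_2(k,m)\lambda^{n-k}$, which is what the composition with
  the exponential series requires. The statement for an indeterminate $x$ follows by evaluating
  at every real number.
\<close>

text \<open>Needed over an arbitrary commutative ring, since it is applied at the real point
  \<open>real j / lam\<close>. The induction rests on the coefficient recurrence obtained by
  multiplying the product by \<open>[:- int n, 1:]\<close>.\<close>

lemma falling_factorial_eq_sum_of_int_signed_stirling:
  fixes x :: "'a::comm_ring_1"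
  shows "(\<Prod>i<n. x - of_nat i) = (\<Sum>l\<le>n. of_int (signed_stirling n l) * x ^ l)"
proof (induction n)
  case 0
  show ?case by (simp add: signed_stirling_def)
next
  case (Suc n)
  have rec: "signed_stirling (Suc n) l
      = (case l of 0 \<Rightarrow> 0 | Suc m \<Rightarrow> signed_stirling n m) - int n * signed_stirling n l" for l
    by (simp add: signed_stirling_def mult.commute coeff_pCons split: nat.split)
  have top: "signed_stirling n (Suc n) = 0"
    unfolding signed_stirling_def
    by (rule coeff_eq_0) (subst degree_prod_eq_sum_degree; simp)
  have "(\<Sum>l\<le>Suc n. of_int (signed_stirling (Suc n) l) * x ^ l)
      = (\<Sum>l\<le>Suc n. of_int (case l of 0 \<Rightarrow> 0 | Suc m \<Rightarrow> signed_stirling n m) * x ^ l)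
        - of_nat n * (\<Sum>l\<le>Suc n. of_int (signed_stirling n l) * x ^ l)"
    by (simp only: rec of_int_diff of_int_mult of_int_of_nat_eq left_diff_distrib sum_subtractf
        sum_distrib_left mult.assoc)
  also have "(\<Sum>l\<le>Suc n. of_int (case l of 0 \<Rightarrow> 0 | Suc m \<Rightarrow> signed_stirling n m) * x ^ l)
      = x * (\<Sum>l\<le>n. of_int (signed_stirling n l) * x ^ l)"
    by (subst sum.atMost_Suc_shift) (simp add: sum_distrib_left mult_ac)
  also have "(\<Sum>l\<le>Suc n. of_int (signed_stirling n l) * x ^ l)
      = (\<Sum>l\<le>n. of_int (signed_stirling n l) * x ^ l)"
    by (simp add: top)
  finally have sum_Suc: "(\<Sum>l\<le>Suc n. of_int (signed_stirling (Suc n) l) * x ^ l)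
      = x * (\<Sum>l\<le>n. of_int (signed_stirling n l) * x ^ l)
        - of_nat n * (\<Sum>l\<le>n. of_int (signed_stirling n l) * x ^ l)" .
  show ?case
    unfolding sum_Suc Suc.IH[symmetric] by (simp add: algebra_simps)
qed

text \<open>The falling factorial of \<open>j\<close> of length \<open>l\<close> is
  \<open>fact l * (j choose l)\<close>. Terms vanish for \<open>l > k\<close> and for
  \<open>l > j\<close>, so the sum can stop at \<open>j\<close>, a bound independent of
  \<open>k\<close>, as binomial inversion requires.\<close>

lemma of_nat_power_eq_sum_binomial_Stirling:
  "of_nat j ^ k = (\<Sum>l\<le>j. of_nat (j choose l) * (fact l * of_nat (Stirling k l)) :: 'a::field_char_0)"
proof -
  have "of_nat j ^ k = (\<Sum>l\<le>k. of_nat (Stirling k l) * (\<Prod>i<l. of_nat j - of_nat i) :: 'a)"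
    by (rule power_eq_sum_Stirling)
  also have "\<dots> = (\<Sum>l\<le>k. of_nat (j choose l) * (fact l * of_nat (Stirling k l)))"
    by (intro sum.cong refl)
      (simp add: binomial_gbinomial gbinomial_prod_rev lessThan_atLeast0)
  also have "\<dots> = (\<Sum>l\<le>max j k. of_nat (j choose l) * (fact l * of_nat (Stirling k l)))"
    by (intro sum.mono_neutral_left) (auto simp: not_le)
  also have "\<dots> = (\<Sum>l\<le>j. of_nat (j choose l) * (fact l * of_nat (Stirling k l)))"
    by (intro sum.mono_neutral_right) (auto simp: not_le binomial_eq_0)
  finally show ?thesis .
qed

text \<open>The transform is triangular with diagonal entries \<open>m choose m = 1\<close>, so
  strong induction cancels all terms below \<open>m\<close>.\<close>

lemma binomial_transform_inj:
  fixes a b :: "nat \<Rightarrow> 'a::comm_ring_1"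
  assumes "\<And>j. (\<Sum>m\<le>j. of_nat (j choose m) * a m) = (\<Sum>m\<le>j. of_nat (j choose m) * b m)"
  shows "a m = b m"
proof (induction m rule: less_induct)
  case (less m)
  have "(\<Sum>i<m. of_nat (m choose i) * a i) = (\<Sum>i<m. of_nat (m choose i) * b i)"
    using less by simp
  with assms[of m] show ?case
    by (simp add: lessThan_Suc_atMost[symmetric])
qed

text \<open>Both sides solve \<open>(1 + X) f' = c f\<close> with constant term 1, which determines
  the series.\<close>

lemma fps_exp_compose_ln:
  fixes c :: "'a::field_char_0"
  shows "fps_exp c oo fps_ln 1 = fps_binomial c"
proof -
  let ?f = "fps_exp c oo fps_ln 1"
  have "fps_deriv ?f = fps_const c * ?f / (1 + fps_X)"
    by (simp add: fps_compose_deriv fps_compose_mult_distrib fps_ln_deriv fps_divide_unit)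
  then show ?thesis
    by (simp add: fps_binomial_ODE_unique)
qed

lemma degenerate_exp_power:
  "degenerate_exp lam ^ j = fps_binomial (real j / lam) oo (fps_const lam * fps_X)"
proof -
  have "degenerate_exp lam ^ j = fps_exp (1 / lam) ^ j oo (fps_ln 1 oo (fps_const lam * fps_X))"
    unfolding degenerate_exp_def by (rule fps_compose_power) simp
  also have "\<dots> = (fps_exp (real j / lam) oo fps_ln 1) oo (fps_const lam * fps_X)"
    by (simp add: fps_exp_power_mult fps_compose_assoc)
  finally show ?thesis
    by (simp add: fps_exp_compose_ln)
qed

lemma fact_mult_degenerate_exp_power_nth:
  assumes "lam \<noteq> 0"
  shows "fact n * fps_nth (degenerate_exp lam ^ j) n
    = (\<Sum>k\<le>n. real_of_int (signed_stirling n k) * lam ^ (n - k) * real j ^ k)"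
proof -
  \<comment> \<open>Substituting \<open>lam * X\<close> scales the n-th coefficient by
    \<open>lam ^ n\<close>; \<open>fact n\<close> clears the denominator of the generalized binomial
    coefficient.\<close>
  have "fact n * fps_nth (degenerate_exp lam ^ j) n = lam ^ n * (\<Prod>i<n. real j / lam - real i)"
    by (simp add: degenerate_exp_power gbinomial_prod_rev lessThan_atLeast0)
  also have "\<dots> = (\<Sum>k\<le>n. real_of_int (signed_stirling n k) * lam ^ (n - k) * real j ^ k)"
    unfolding falling_factorial_eq_sum_of_int_signed_stirling sum_distrib_left
    using assms by (intro sum.cong refl) (simp add: power_divide power_diff)
  finally show ?thesis .
qed

lemma fact_mult_degenerate_exp_minus_1_power_nth:
  assumes "lam \<noteq> 0"
  shows "fact n * fps_nth ((degenerate_exp lam - 1) ^ m) n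
    = fact m * (\<Sum>k\<le>n. real_of_int (signed_stirling n k) * lam ^ (n - k) * real (Stirling k m))"
proof (rule binomial_transform_inj[where m = m
      and a = "\<lambda>m. fact n * fps_nth ((degenerate_exp lam - 1) ^ m) n"
      and b = "\<lambda>m. fact m *
        (\<Sum>k\<le>n. real_of_int (signed_stirling n k) * lam ^ (n - k) * real (Stirling k m))"])
  fix j :: nat
  define E where "E = degenerate_exp lam - 1"
  have "(\<Sum>m\<le>j. real (j choose m) * (fact n * fps_nth (E ^ m) n))
      = fact n * fps_nth (\<Sum>m\<le>j. of_nat (j choose m) * E ^ m) n"
    by (simp add: fps_sum_nth sum_distrib_left fps_of_nat[symmetric] mult_ac)
  also have "(\<Sum>m\<le>j. of_nat (j choose m) * E ^ m) = (E + 1) ^ j"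
    by (simp add: binomial_ring)
  also have "E + 1 = degenerate_exp lam"
    by (simp add: E_def)
  also have "fact n * fps_nth (degenerate_exp lam ^ j) n
      = (\<Sum>k\<le>n. \<Sum>m\<le>j. real_of_int (signed_stirling n k) * lam ^ (n - k)
           * (real (j choose m) * (fact m * real (Stirling k m))))"
    unfolding fact_mult_degenerate_exp_power_nth[OF assms] of_nat_power_eq_sum_binomial_Stirling
      sum_distrib_left ..
  also have "\<dots> = (\<Sum>m\<le>j. real (j choose m) * (fact m *
      (\<Sum>k\<le>n. real_of_int (signed_stirling n k) * lam ^ (n - k) * real (Stirling k m))))"
    by (subst sum.swap) (simp add: sum_distrib_left mult_ac)
  finally show "(\<Sum>m\<le>j. real (j choose m) * (fact n * fps_nth ((degenerate_exp lam - 1) ^ m) n))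
    = (\<Sum>m\<le>j. real (j choose m) * (fact m *
      (\<Sum>k\<le>n. real_of_int (signed_stirling n k) * lam ^ (n - k) * real (Stirling k m))))"
    unfolding E_def .
qed

lemma degenerate_bell_eq_sum_Stirling:
  assumes "lam \<noteq> 0"
  shows "degenerate_bell n lam x =
    (\<Sum>k=0..n. \<Sum>m=0..k. (ln (1 + lam) / lam) ^ m * real_of_int (signed_stirling n k)
       * real (Stirling k m) * lam ^ (n - k) * x ^ m)"
proof -
  define c where "c = x / lam * ln (1 + lam)"
  have "degenerate_bell n lam x
      = (\<Sum>m=0..n. c ^ m / fact m * (fact n * fps_nth ((degenerate_exp lam - 1) ^ m) n))"
    by (simp add: degenerate_bell_def fps_compose_nth c_def sum_distrib_left mult_ac)
  also have "\<dots> = (\<Sum>m=0..n. \<Sum>k=0..n. c ^ m *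
      (real_of_int (signed_stirling n k) * lam ^ (n - k) * real (Stirling k m)))"
    by (simp add: fact_mult_degenerate_exp_minus_1_power_nth[OF assms] sum_distrib_left
        atMost_atLeast0 mult.assoc)
  also have "\<dots> = (\<Sum>k=0..n. \<Sum>m=0..n. c ^ m *
      (real_of_int (signed_stirling n k) * lam ^ (n - k) * real (Stirling k m)))"
    by (rule sum.swap)
  also have "\<dots> = (\<Sum>k=0..n. \<Sum>m=0..k. c ^ m *
      (real_of_int (signed_stirling n k) * lam ^ (n - k) * real (Stirling k m)))"
    \<comment> \<open>\<open>Stirling k m = 0\<close> for \<open>m > k\<close>.\<close>
    by (intro sum.cong refl sum.mono_neutral_right) auto
  also have "\<dots> = (\<Sum>k=0..n. \<Sum>m=0..k. (ln (1 + lam) / lam) ^ m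
      * real_of_int (signed_stirling n k) * real (Stirling k m) * lam ^ (n - k) * x ^ m)"
    by (simp add: c_def power_mult_distrib power_divide mult_ac)
  finally show ?thesis .
qed

text \<open>Evaluation at \<open>x\<close> is a ring homomorphism, and each coefficient of a product
  of series is a finite sum of products.\<close>

lemma poly_fps_power_nth:
  fixes F :: "'a::comm_ring_1 poly fps"
  shows "poly (fps_nth (F ^ i) n) x = fps_nth (Abs_fps (\<lambda>k. poly (fps_nth F k) x) ^ i) n"
  by (induction i arbitrary: n) (simp_all add: fps_mult_nth poly_sum)

lemma poly_degenerate_bell_poly: "poly (degenerate_bell_poly n lam) x = degenerate_bell n lam x"
proof -
  have "Abs_fps (\<lambda>k. poly (fps_nth (Abs_fps (\<lambda>k. [:fps_nth (degenerate_exp lam) k:]) - 1) k) x)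
      = degenerate_exp lam - 1"
    by (simp add: fps_eq_iff)
  moreover have "poly (fact n) x = fact n"
    by (metis of_nat_fact poly_of_nat)
  ultimately show ?thesis
    by (simp add: degenerate_bell_poly_def degenerate_bell_def fps_compose_nth poly_sum
        fps_exp_poly_def poly_fps_power_nth mult_ac)
qed

theorem theorem1:
  fixes lam x :: real and n :: nat
  assumes "lam > -1" and "lam \<noteq> 0"
  shows "degenerate_bell n lam x =
           (\<Sum>k=0..n. \<Sum>m=0..k. (ln (1 + lam) / lam) ^ m * real_of_int (signed_stirling n k)
              * real (Stirling k m) * lam ^ (n - k) * x ^ m)
       \<and> degenerate_bell_poly n lam =
           (\<Sum>k=0..n. \<Sum>m=0..k. smult ((ln (1 + lam) / lam) ^ m * real_of_int (signed_stirling n k)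
              * real (Stirling k m) * lam ^ (n - k)) ([:0, 1:] ^ m))"
proof
  show "degenerate_bell_poly n lam =
      (\<Sum>k=0..n. \<Sum>m=0..k. smult ((ln (1 + lam) / lam) ^ m * real_of_int (signed_stirling n k)
         * real (Stirling k m) * lam ^ (n - k)) ([:0, 1:] ^ m))"
    \<comment> \<open>Over the infinite field of reals, polynomials with equal values everywhere are
      equal, which reduces the claim to real \<open>x\<close>.\<close>
    unfolding poly_eq_poly_eq_iff[symmetric] fun_eq_iff
    by (simp add: poly_degenerate_bell_poly degenerate_bell_eq_sum_Stirling[OF assms(2)] poly_sum)
qed (rule degenerate_bell_eq_sum_Stirling[OF assms(2)])

end
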